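(* Let $(X,Y)$ be a pair of real-valued random variables with distribution $R$ on $\mathbb{R}\times\mathbb{R}$, let $P$ be the distribution of $X$, and let $\mathcal{X}$ be the range of $X$. The following three conditions are equivalent: (i) For arbitrary Borel sets $A_1,A_2\subset\mathbb{R}$ with $A_1<A_2$ and real numbers $y$, \[ R(A_1\times(y,\infty))\,P(A_2)\ \le\ P(A_1)\,R(A_2\times(y,\infty)). \qquad ( * ) \] (ii) There exists a dense subset $D$ of $\mathbb{R}$ such that for arbitrary numbers $x_0<x_1<x_2$ and $y$ in $D$, $( * )$ holds true with $A_1=(x_0,x_1]$ and $A_2=(x_1,x_2]$. (iii) There exists a stochastic kernel $K$ describing the conditional distribution of $Y$ given $X$ such that $K(x_1,\cdot)\le_{\rm st}K(x_2,\cdot)$ for arbitrary $x_1,x_2\in\mathcal{X}$ with $x_1<x_2$.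
   Context: $\mathcal{B}$ is the Borel $\sigma$-field on $\mathbb{R}$. For sets, $A_1<A_2$ means $a_1<a_2$ for all $a_1\in A_1,a_2\in A_2$. Range of $X$: $\mathcal{X}:=\{x\in\mathbb{R}:\mathbb{P}(X\le x)>0\text{ and }\mathbb{P}(X\ge x)>0\}$. A stochastic kernel describing the conditional distribution of $Y$ given $X$ is a map $K:\mathbb{R}\times\mathcal{B}\to[0,1]$ such that $K(x,\cdot)$ is a probability measure for every $x\in\mathbb{R}$, $K(\cdot,B)$ is measurable for every $B\in\mathcal{B}$, and $R(A\times B)=\int_A K(x,B)\,P(\mathrm{d}x)$ for all $A,B\in\mathcal{B}$. Stochastic order: $Q_1\le_{\rm st}Q_2$ means $Q_1((y,\infty))\le Q_2((y,\infty))$ for all $y\in\mathbb{R}$. *)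

theory Defs
  imports "HOL-Probability.Probability"
begin

definition set_less :: "real set \<Rightarrow> real set \<Rightarrow> bool" where
  "set_less A\<^sub>1 A\<^sub>2 \<longleftrightarrow> (\<forall>a\<^sub>1\<in>A\<^sub>1. \<forall>a\<^sub>2\<in>A\<^sub>2. a\<^sub>1 < a\<^sub>2)"

text \<open>Not the image of \<open>X\<close> but an interval carrying its distribution;
  an endpoint belongs to it only if it is an atom.\<close>

definition rv_range :: "'a measure \<Rightarrow> ('a \<Rightarrow> real) \<Rightarrow> real set" where
  "rv_range M X = {x. \<P>(\<omega> in M. X \<omega> \<le> x) > 0 \<and> \<P>(\<omega> in M. X \<omega> \<ge> x) > 0}"

definition stoch_le :: "real measure \<Rightarrow> real measure \<Rightarrow> bool" where
  "stoch_le Q\<^sub>1 Q\<^sub>2 \<longleftrightarrow> (\<forall>y. measure Q\<^sub>1 {y<..} \<le> measure Q\<^sub>2 {y<..})"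

text \<open>\<open>R\<close> is the joint distribution and \<open>P\<close> its first marginal. The first two conjuncts
  say that every \<open>K x\<close> is a Borel probability measure on the real line.\<close>

definition conditional_kernel ::
  "(real \<times> real) measure \<Rightarrow> real measure \<Rightarrow> (real \<Rightarrow> real measure) \<Rightarrow> bool" where
  "conditional_kernel R P K \<longleftrightarrow>
     (\<forall>x. prob_space (K x)) \<and>
     (\<forall>x. sets (K x) = sets borel) \<and>
     (\<forall>B\<in>sets borel. (\<lambda>x. measure (K x) B) \<in> borel_measurable borel) \<and>
     (\<forall>A\<in>sets borel. \<forall>B\<in>sets borel.
        measure R (A \<times> B) = (LINT x:A|P. measure (K x) B))"

definition order_ineq ::
  "(real \<times> real) measure \<Rightarrow> real measure \<Rightarrow> real set \<Rightarrow> real set \<Rightarrow> real \<Rightarrow> bool" where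
  "order_ineq R P A\<^sub>1 A\<^sub>2 y \<longleftrightarrow>
     measure R (A\<^sub>1 \<times> {y<..}) * measure P A\<^sub>2 \<le> measure P A\<^sub>1 * measure R (A\<^sub>2 \<times> {y<..})"

end

theory Submission
  imports Defs
begin

text \<open>
  The main step is from (ii) to (iii). By right-continuity of distribution functions, (ii) extends to all
  real \<open>x\<^sub>0 < x\<^sub>1 < x\<^sub>2\<close> and \<open>y\<close>. Let
  \<open>g\<^sub>y(x)\<close> be the supremum of the quotients \<open>R((a,b] \<times> (y,\<infinity>)) /
  P((a,b])\<close> over \<open>a < b \<le> x\<close>. It is increasing in \<open>x\<close>, and
  decreasing and right-continuous in \<open>y\<close>, for all arguments and not merely almost
  everywhere. The ordering of the quotients gives \<open>R(A \<times> (y,\<infinity>)) \<le> g\<^sub>y(x)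
  P(A)\<close> for Borel sets \<open>A\<close> to the left of \<open>x\<close> and the reverse inequality
  for those to the right (\<open>x\<close> included in both cases). Cutting \<open>A\<close> along the
  levels of \<open>g\<^sub>y\<close> shows that \<open>g\<^sub>y\<close> is the \<open>P\<close>-density
  of \<open>A \<mapsto> R(A \<times> (y,\<infinity>))\<close>, and \<open>A = (-\<infinity>,x]\<close>,
  \<open>A = [x,\<infinity>)\<close> give the limits of \<open>g\<^sub>y(x)\<close> for \<open>y
  \<rightarrow> -\<infinity>\<close> and \<open>y \<rightarrow> \<infinity>\<close> when \<open>x\<close>
  is in the range of \<open>X\<close>. So \<open>1 - g\<^sub>y(x)\<close> is a distribution function in
  \<open>y\<close>, which defines the kernel.

  For (iii) to (i), with \<open>A\<^sub>1 < A\<^sub>2\<close> the supremum of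
  \<open>K(x,(y,\<infinity>))\<close> over \<open>x \<in> A\<^sub>1\<close> in the range separates the
  conditional means over \<open>A\<^sub>1\<close> and \<open>A\<^sub>2\<close>; the range has full
  \<open>P\<close>-measure.
\<close>

section \<open>Comparison of finite measures on the line\<close>

text \<open>The difference of the two distribution functions is itself a distribution function, so
  \<open>\<nu>\<close> is \<open>\<mu>\<close> plus a measure.\<close>

lemma finite_borel_measure_le_of_Ioc:
  assumes "finite_borel_measure \<mu>" "finite_borel_measure \<nu>"
    and le: "\<And>a b. a < b \<Longrightarrow> measure \<mu> {a<..b} \<le> measure \<nu> {a<..b}"
    and A: "A \<in> sets borel"
  shows "measure \<mu> A \<le> measure \<nu> A"
proof -
  interpret \<mu>: finite_borel_measure \<mu> by fact
  interpret \<nu>: finite_borel_measure \<nu> by fact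
  define F where "F t = cdf \<nu> t - cdf \<mu> t" for t
  let ?m = "measure \<nu> (space \<nu>) - measure \<mu> (space \<mu>)"
  have mono: "F x \<le> F y" if "x \<le> y" for x y
    using that le[of x y] \<mu>.cdf_diff_eq[of x y] \<nu>.cdf_diff_eq[of x y]
    unfolding F_def by (cases "x = y") auto
  have rc: "continuous (at_right a) F" for a
    unfolding F_def by (intro continuous_intros \<mu>.cdf_is_right_cont \<nu>.cdf_is_right_cont)
  have bot: "(F \<longlongrightarrow> 0) at_bot"
    unfolding F_def using tendsto_diff[OF \<nu>.cdf_lim_at_bot \<mu>.cdf_lim_at_bot] by simp
  have top: "(F \<longlongrightarrow> ?m) at_top"
    unfolding F_def by (intro tendsto_diff \<nu>.cdf_lim_at_top \<mu>.cdf_lim_at_top)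
  have F0: "0 \<le> F x" for x
    by (rule tendsto_upperbound[OF bot eventually_mono[OF eventually_le_at_bot[of x] mono]]) simp_all
  have m: "0 \<le> ?m"
    using tendsto_lowerbound[OF top, of 0] F0 by simp
  interpret \<rho>: finite_borel_measure "interval_measure F"
    by (rule finite_borel_measure_interval_measure[OF mono rc bot top m])
  have Iic: "measure (interval_measure F) {..x} = F x" for x
    using emeasure_interval_measure_Iic[OF mono rc bot, of x] F0[of x]
    by (simp add: measure_def)
  have UNIV: "measure (interval_measure F) UNIV = ?m"
    using interval_measure_UNIV[OF mono rc bot top m] m by (simp add: measure_def)
  have b: "sets borel = sigma_sets UNIV (range (\<lambda>x::real. {..x}))"
    unfolding borel_eq_atMost by (subst sets_measure_of) auto
  have Int: "Int_stable (range (\<lambda>x::real. {..x}))"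
    by (auto simp: Int_stable_def)
  have Pow: "range (\<lambda>x::real. {..x}) \<subseteq> Pow UNIV" by simp
  have "A \<in> sigma_sets UNIV (range (\<lambda>x::real. {..x}))" using A b by simp
  then have "measure \<nu> A = measure \<mu> A + measure (interval_measure F) A"
  proof (induction A rule: sigma_sets_induct_disjoint[OF Int Pow, consumes 1, case_names basic empty compl union])
    case (basic A)
    then obtain x where "A = {..x}" by auto
    then show ?case using Iic[of x] by (simp add: F_def[of x] cdf_def)
  next
    case empty
    then show ?case by simp
  next
    case (compl A)
    then have "A \<in> sets borel" using b by simp
    then have "measure \<nu> (UNIV - A) = measure \<nu> UNIV - measure \<nu> A"
      "measure \<mu> (UNIV - A) = measure \<mu> UNIV - measure \<mu> A"
      "measure (interval_measure F) (UNIV - A) = measure (interval_measure F) UNIV - measure (interval_measure F) A"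
      using \<mu>.finite_measure_compl[of A] \<nu>.finite_measure_compl[of A] \<rho>.finite_measure_compl[of A]
      by (auto simp: \<mu>.borel_UNIV \<nu>.borel_UNIV \<mu>.M_is_borel \<nu>.M_is_borel)
    then show ?case using compl UNIV by (simp add: \<mu>.borel_UNIV \<nu>.borel_UNIV)
  next
    case (union A)
    then have "range A \<subseteq> sets borel" using b by auto
    then have r: "range A \<subseteq> sets \<nu>" "range A \<subseteq> sets \<mu>" "range A \<subseteq> sets (interval_measure F)"
      by (auto simp: \<mu>.M_is_borel \<nu>.M_is_borel)
    note d = \<open>disjoint_family A\<close>
    have "(\<lambda>i. measure \<nu> (A i)) sums
      (measure \<mu> (\<Union>i. A i) + measure (interval_measure F) (\<Union>i. A i))"
      unfolding union(3)
      by (intro sums_add \<mu>.finite_measure_UNION[OF r(2) d] \<rho>.finite_measure_UNION[OF r(3) d])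
    with \<nu>.finite_measure_UNION[OF r(1) d] show ?case by (rule sums_unique2)
  qed
  then show ?thesis by simp
qed

text \<open>Scaling by \<open>c\<close> and restricting to \<open>S\<close> are coded as a density,
  so that inequalities between multiples of two measures on a half-line fall under the comparison of
  two measures on the whole line.\<close>

lemma measure_density_const_indicator:
  assumes "finite_borel_measure \<mu>" "S \<in> sets borel" "0 \<le> c" "A \<in> sets borel"
  shows "measure (density \<mu> (\<lambda>x. ennreal c * indicator S x)) A = c * measure \<mu> (A \<inter> S)"
proof -
  interpret finite_borel_measure \<mu> by fact
  have [measurable]: "S \<in> sets \<mu>" "A \<in> sets \<mu>" using assms M_is_borel by auto
  have "emeasure (density \<mu> (\<lambda>x. ennreal c * indicator S x)) A
    = (\<integral>\<^sup>+x. ennreal c * indicator (A \<inter> S) x \<partial>\<mu>)"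
    by (subst emeasure_density) (auto intro!: nn_integral_cong split: split_indicator)
  also have "\<dots> = ennreal (c * measure \<mu> (A \<inter> S))"
    using assms(3) by (subst nn_integral_cmult) (auto simp: emeasure_eq_measure ennreal_mult)
  finally show ?thesis using assms(3) by (simp add: measure_def)
qed

lemma finite_borel_measure_density_const_indicator:
  assumes "finite_borel_measure \<mu>" "S \<in> sets borel" "0 \<le> c"
  shows "finite_borel_measure (density \<mu> (\<lambda>x. ennreal c * indicator S x))"
proof -
  interpret finite_borel_measure \<mu> by fact
  have [measurable]: "S \<in> sets \<mu>" using assms M_is_borel by auto
  have "emeasure (density \<mu> (\<lambda>x. ennreal c * indicator S x)) (space \<mu>)
    = (\<integral>\<^sup>+x. ennreal c * indicator S x \<partial>\<mu>)"
    by (subst emeasure_density) (auto intro!: nn_integral_cong split: split_indicator)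
  also have "\<dots> = ennreal (c * measure \<mu> S)"
    using assms(3) by (subst nn_integral_cmult) (auto simp: emeasure_eq_measure ennreal_mult)
  finally have "emeasure (density \<mu> (\<lambda>x. ennreal c * indicator S x)) (space \<mu>) \<noteq> \<infinity>"
    by (simp only: infinity_ennreal_def ennreal_neq_top not_False_eq_True)
  then show ?thesis
    by (intro finite_borel_measure.intro finite_borel_measure_axioms.intro finite_measureI)
      (simp_all only: space_density sets_density M_is_borel not_False_eq_True)
qed

text \<open>Both weighted restrictions are finite Borel measures on the line, so comparing them on
  half-open intervals suffices. It is used for half-lines ending or starting at a point
  \<open>x\<close>, with one of the two weights equal to 1.\<close>

lemma finite_borel_measure_le_of_Ioc_on:
  assumes \<mu>: "finite_borel_measure \<mu>" and \<nu>: "finite_borel_measure \<nu>"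
    and S: "S \<in> sets borel" and "0 \<le> c" "0 \<le> d"
    and le: "\<And>a b. a < b \<Longrightarrow> c * measure \<mu> ({a<..b} \<inter> S) \<le> d * measure \<nu> ({a<..b} \<inter> S)"
    and A: "A \<in> sets borel" "A \<subseteq> S"
  shows "c * measure \<mu> A \<le> d * measure \<nu> A"
proof -
  have "c * measure \<mu> (A \<inter> S) \<le> d * measure \<nu> (A \<inter> S)"
    using finite_borel_measure_le_of_Ioc[OF
      finite_borel_measure_density_const_indicator[OF \<mu> S \<open>0 \<le> c\<close>]
      finite_borel_measure_density_const_indicator[OF \<nu> S \<open>0 \<le> d\<close>] _ A(1)]
    by (simp only: measure_density_const_indicator[OF \<mu> S \<open>0 \<le> c\<close>] le A(1)
      measure_density_const_indicator[OF \<nu> S \<open>0 \<le> d\<close>] greaterThanAtMost_borel)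
  moreover have "A \<inter> S = A" using A(2) by (rule Int_absorb2)
  ultimately show ?thesis by (simp only:)
qed

section \<open>Cofinal sequences and null half-lines\<close>

text \<open>If \<open>S\<close> has no maximum, a rational lies between any of its points and a
  larger one. Choosing one point of \<open>S\<close> above each rational that \<open>S\<close>
  exceeds gives a countable cofinal subset, and the running maxima of an enumeration
  increase.\<close>

lemma cofinal_incseq:
  fixes S :: "real set"
  assumes "S \<noteq> {}"
  obtains x where "incseq x" "range x \<subseteq> S" "\<And>s. s \<in> S \<Longrightarrow> \<exists>n::nat. s \<le> x n"
proof (cases "\<exists>m\<in>S. \<forall>s\<in>S. s \<le> m")
  case True
  then obtain m where "m \<in> S" "\<forall>s\<in>S. s \<le> m" by blast
  then show ?thesis by (intro that[of "\<lambda>_. m"]) (auto simp: incseq_def)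
next
  case False
  define f where "f q = (SOME s. s \<in> S \<and> q \<le> s)" for q
  have f: "f q \<in> S \<and> q \<le> f q" if "\<exists>s\<in>S. q \<le> s" for q
    using someI_ex[of "\<lambda>s. s \<in> S \<and> q \<le> s"] that unfolding f_def by blast
  define C where "C = f ` {q\<in>\<rat>. \<exists>s\<in>S. q \<le> s}"
  have "countable C"
    unfolding C_def by (rule countable_image, rule countable_subset[OF _ countable_rat]) blast
  have CS: "C \<subseteq> S" unfolding C_def using f by blast
  have cof: "\<exists>c\<in>C. s \<le> c" if s: "s \<in> S" for s
  proof -
    obtain t where t: "t \<in> S" "s < t" using False s by (meson not_le)
    then obtain q where q: "q \<in> \<rat>" "s < q" "q < t" using Rats_dense_in_real by blast
    have ex: "\<exists>s\<in>S. q \<le> s" using t q less_imp_le by blast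
    then have "f q \<in> C" unfolding C_def using q(1) by blast
    moreover have "s \<le> f q" using f[OF ex] q by linarith
    ultimately show ?thesis by blast
  qed
  have "C \<noteq> {}" using cof assms by blast
  define x where "x n = Max (from_nat_into C ` {..n})" for n :: nat
  have "incseq x" unfolding x_def incseq_def by (auto intro!: Max_mono)
  moreover have "x n \<in> S" for n
  proof -
    have "x n \<in> from_nat_into C ` {..n}" unfolding x_def by (rule Max_in) auto
    then show ?thesis using from_nat_into[OF \<open>C \<noteq> {}\<close>] CS by auto
  qed
  moreover have "\<exists>n. s \<le> x n" if s: "s \<in> S" for s
  proof -
    obtain c where c: "c \<in> C" "s \<le> c" using cof[OF s] by blast
    then obtain n where n: "from_nat_into C n = c"
      using from_nat_into_surj[OF \<open>countable C\<close>] by blast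
    then have "c \<le> x n" unfolding x_def by (auto intro!: Max_ge)
    then show ?thesis using c by (intro exI[of _ n]) simp
  qed
  ultimately show ?thesis using that by blast
qed

lemma cofinal_decseq:
  fixes S :: "real set"
  assumes "S \<noteq> {}"
  obtains x where "decseq x" "range x \<subseteq> S" "\<And>s. s \<in> S \<Longrightarrow> \<exists>n::nat. x n \<le> s"
proof -
  obtain x where x: "incseq x" "range x \<subseteq> uminus ` S" "\<And>s. s \<in> uminus ` S \<Longrightarrow> \<exists>n::nat. s \<le> x n"
    using cofinal_incseq[of "uminus ` S"] assms by auto
  show ?thesis
  proof (rule that[of "\<lambda>n. - x n"])
    show "\<exists>n. - x n \<le> s" if "s \<in> S" for s
      using x(3)[of "-s"] that by (auto intro!: exI simp: minus_le_iff)
    have "- x n \<in> S" for n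
    proof -
      obtain s where "x n = - s" "s \<in> S" using x(2) by blast
      then show ?thesis by simp
    qed
    then show "range (\<lambda>n. - x n) \<subseteq> S" by blast
    show "decseq (\<lambda>n. - x n)" using x(1) by (simp add: incseq_def decseq_def)
  qed
qed

text \<open>A cofinal sequence replaces the possibly uncountable union of null half-lines
  \<open>{..x}\<close> by a countable one. The set \<open>S\<close> itself need not be measurable,
  hence the covering set \<open>N\<close>.\<close>

lemma (in finite_borel_measure) null_downset:
  assumes "\<And>x. x \<in> S \<Longrightarrow> measure M {..x} = 0"
  obtains N where "S \<subseteq> N" "N \<in> null_sets M"
proof (cases "S = {}")
  case True
  then show ?thesis using that[of "{}"] by auto
next
  case False
  then obtain x where x: "incseq x" "range x \<subseteq> S" "\<And>s. s \<in> S \<Longrightarrow> \<exists>n::nat. s \<le> x n"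
    by (rule cofinal_incseq) blast
  have N: "(\<Union>n. {..x n}) \<in> null_sets M"
    using x(2) assms M_is_borel
    by (intro null_sets_UN) (auto simp: emeasure_eq_measure null_sets_def)
  have "S \<subseteq> (\<Union>n. {..x n})" using x(3) by blast
  then show ?thesis using N by (rule that)
qed

lemma (in finite_borel_measure) null_upset:
  assumes "\<And>x. x \<in> S \<Longrightarrow> measure M {x..} = 0"
  obtains N where "S \<subseteq> N" "N \<in> null_sets M"
proof (cases "S = {}")
  case True
  then show ?thesis using that[of "{}"] by auto
next
  case False
  then obtain x where x: "decseq x" "range x \<subseteq> S" "\<And>s. s \<in> S \<Longrightarrow> \<exists>n::nat. x n \<le> s"
    by (rule cofinal_decseq) blast
  have N: "(\<Union>n. {x n..}) \<in> null_sets M"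
    using x(2) assms M_is_borel
    by (intro null_sets_UN) (auto simp: emeasure_eq_measure null_sets_def)
  have "S \<subseteq> (\<Union>n. {x n..})" using x(3) by blast
  then show ?thesis using N by (rule that)
qed

section \<open>Monotone densities\<close>

text \<open>Intervals that are null for \<open>P\<close> contribute \<open>x / 0 = 0\<close>, which is harmless since the
  other quotients are nonnegative.\<close>

definition left_ratio_sup :: "real measure \<Rightarrow> real measure \<Rightarrow> real \<Rightarrow> real" where
  "left_ratio_sup P N x =
     (SUP I\<in>{(a, b). a < b \<and> b \<le> x}. measure N {fst I<..snd I} / measure P {fst I<..snd I})"

text \<open>In the application \<open>N\<close> is the measure of A x (y, infinity) under the joint
  law, as a function of A, for one fixed y. The inequality \<open>ratio\<close> for adjacent
  intervals is stated as a product, which stays meaningful when an interval is null for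
  \<open>P\<close>.\<close>

locale increasing_ratio = P: finite_borel_measure P + N: finite_borel_measure N
  for P N :: "real measure" +
  assumes dominated: "A \<in> sets borel \<Longrightarrow> measure N A \<le> measure P A"
    and ratio: "a < b \<Longrightarrow> b < c \<Longrightarrow>
      measure N {a<..b} * measure P {b<..c} \<le> measure P {a<..b} * measure N {b<..c}"
begin

abbreviation g :: "real \<Rightarrow> real" where "g \<equiv> left_ratio_sup P N"

lemma quotient_le_1: "A \<in> sets borel \<Longrightarrow> measure N A / measure P A \<le> 1"
  using dominated[of A] by (auto simp: divide_le_eq_1 not_less zero_less_measure_iff)

lemma bdd_above_quotients:
  "bdd_above ((\<lambda>I. measure N {fst I<..snd I} / measure P {fst I<..snd I}) ` S)"
  using quotient_le_1 by (intro bdd_aboveI[of _ 1]) auto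

lemma intervals_ne: "{(a, b). a < b \<and> b \<le> x} \<noteq> {}" for x :: real
  using lt_ex[of x] by auto

lemma quotient_le_g: "a < b \<Longrightarrow> b \<le> x \<Longrightarrow> measure N {a<..b} / measure P {a<..b} \<le> g x"
  unfolding left_ratio_sup_def
  using cSUP_upper[OF _ bdd_above_quotients, of "(a, b)" "{(a, b). a < b \<and> b \<le> x}"] by simp

lemma g_nonneg: "0 \<le> g x"
  using order_trans[OF _ quotient_le_g[of "x - 1" x x]] by simp

lemma g_le_1: "g x \<le> 1"
  unfolding left_ratio_sup_def by (rule cSUP_least[OF intervals_ne]) (simp add: quotient_le_1)

lemma mono_g: "mono g"
  unfolding left_ratio_sup_def
  by (intro monoI cSUP_subset_mono[OF intervals_ne bdd_above_quotients]) auto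

lemma g_measurable [measurable]: "g \<in> borel_measurable borel"
  by (rule borel_measurable_mono[OF mono_g])

lemma measure_N_eq_0: "A \<in> sets borel \<Longrightarrow> measure P A = 0 \<Longrightarrow> measure N A = 0"
  using dominated[of A] measure_nonneg[of N A] by linarith

lemma measure_Ioc_split:
  assumes "a \<le> b" "b \<le> c"
  shows "measure P {a<..c} = measure P {a<..b} + measure P {b<..c}"
    "measure N {a<..c} = measure N {a<..b} + measure N {b<..c}"
  using assms P.cdf_diff_eq[of a b] P.cdf_diff_eq[of b c] P.cdf_diff_eq[of a c]
    N.cdf_diff_eq[of a b] N.cdf_diff_eq[of b c] N.cdf_diff_eq[of a c]
  by (cases "a = b"; cases "b = c"; auto)+

text \<open>The inequality is chained through the gap \<open>{b<..c}\<close>, whose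
  \<open>P\<close>-measure then cancels. If the gap is null for \<open>P\<close>, domination makes
  it null for \<open>N\<close> too, and it can be merged into the right-hand interval.\<close>

lemma ratio_gap:
  assumes "a < b" "b \<le> c" "c < d"
  shows "measure N {a<..b} * measure P {c<..d} \<le> measure P {a<..b} * measure N {c<..d}"
proof (cases "b = c")
  case True
  then show ?thesis using ratio assms by simp
next
  case False
  then have "b < c" using assms by simp
  let ?n1 = "measure N {a<..b}" and ?n2 = "measure N {b<..c}" and ?n3 = "measure N {c<..d}"
  let ?p1 = "measure P {a<..b}" and ?p2 = "measure P {b<..c}" and ?p3 = "measure P {c<..d}"
  show ?thesis
  proof (cases "?p2 = 0")
    case True
    then have "?n2 = 0" by (intro measure_N_eq_0) auto
    then show ?thesis
      using ratio[of a b d] True measure_Ioc_split[of b c d] assms \<open>b < c\<close> by simp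
  next
    case False
    then have "?p2 > 0" by (simp add: zero_less_measure_iff)
    have "(?n1 * ?p3) * ?p2 = (?n1 * ?p2) * ?p3" by simp
    also have "\<dots> \<le> (?p1 * ?n2) * ?p3"
      by (intro mult_right_mono ratio assms \<open>b < c\<close>) simp
    also have "\<dots> = ?p1 * (?n2 * ?p3)" by simp
    also have "\<dots> \<le> ?p1 * (?p2 * ?n3)"
      by (intro mult_left_mono ratio assms \<open>b < c\<close>) simp
    finally have "(?n1 * ?p3) * ?p2 \<le> (?p1 * ?n3) * ?p2" by (simp add: ac_simps)
    then show ?thesis using \<open>?p2 > 0\<close> by simp
  qed
qed

section \<open>Bounds on either side of a point\<close>

text \<open>Cutting \<open>{a<..b}\<close> by \<open>{..x}\<close> leaves a half-open interval
  ending at or before \<open>x\<close>, or nothing. Its quotient is therefore one of those in the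
  supremum; if it is null for \<open>P\<close>, domination settles the claim.\<close>

lemma N_le_g_P:
  assumes "A \<in> sets borel" "A \<subseteq> {..x}"
  shows "measure N A \<le> g x * measure P A"
proof -
  have "measure N ({a<..b} \<inter> {..x}) \<le> g x * measure P ({a<..b} \<inter> {..x})" for a b
  proof (cases "a < min b x")
    case True
    then have "measure N {a<..min b x} / measure P {a<..min b x} \<le> g x"
      by (intro quotient_le_g) auto
    moreover have "{a<..b} \<inter> {..x} = {a<..min b x}" by auto
    ultimately show ?thesis
      using measure_N_eq_0[of "{a<..min b x}"] measure_nonneg[of P "{a<..min b x}"]
      by (cases "measure P {a<..min b x} = 0") (auto simp: divide_le_eq split: if_splits)
  next
    case False
    then have "{a<..b} \<inter> {..x} = {}" by auto
    then show ?thesis by simp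
  qed
  then show ?thesis
    using finite_borel_measure_le_of_Ioc_on[of N P "{..x}" 1 "g x" A] assms g_nonneg[of x]
      N.finite_borel_measure_axioms P.finite_borel_measure_axioms by simp
qed

text \<open>If this failed, some \<open>c\<close> would lie strictly between the quotient of
  \<open>A\<close> and \<open>g x\<close>. An interval to the left with quotient above
  \<open>c\<close> forces quotients of at least \<open>c\<close> on everything to the right,
  including \<open>A\<close>. The delicate point is an atom at \<open>x\<close>, since
  \<open>{x..b}\<close> is not half-open on the left.\<close>

lemma g_P_le_N:
  assumes A: "A \<in> sets borel" "A \<subseteq> {x..}"
  shows "g x * measure P A \<le> measure N A"
proof (rule ccontr)
  assume "\<not> ?thesis"
  then have lt: "measure N A < g x * measure P A" by simp
  then have PA: "measure P A > 0"
    using measure_nonneg[of N A] by (auto simp: zero_less_measure_iff)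
  then have "measure N A / measure P A < g x" using lt by (simp add: divide_less_eq)
  then obtain c where c: "measure N A / measure P A < c" "c < g x" using dense by blast
  have "0 \<le> measure N A / measure P A" by simp
  then have c0: "0 \<le> c" using c(1) by linarith
  obtain s t where st: "s < t" "t \<le> x" "c < measure N {s<..t} / measure P {s<..t}"
    using c(2) unfolding left_ratio_sup_def
    by (subst (asm) less_cSUP_iff[OF intervals_ne bdd_above_quotients]) auto
  \<comment> \<open>The bound \<open>c\<close> is passed from a witness \<open>{u<..w}\<close> to
    any interval to its right by \<open>ratio_gap\<close>; the strict inequality makes the witness
    non-null for \<open>P\<close>, which allows cancelling.\<close>
  have Ioc: "c * measure P {v<..b} \<le> measure N {v<..b}"
    if "u < w" "w \<le> v" "v < b" and q: "c * measure P {u<..w} < measure N {u<..w}" for u w v b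
  proof -
    have p: "measure P {u<..w} > 0"
      using q c0 measure_N_eq_0[of "{u<..w}"] by (auto simp: zero_less_measure_iff)
    have "(c * measure P {v<..b}) * measure P {u<..w} = (c * measure P {u<..w}) * measure P {v<..b}"
      by simp
    also have "\<dots> \<le> measure N {u<..w} * measure P {v<..b}"
      using q by (intro mult_right_mono) auto
    also have "\<dots> \<le> measure N {v<..b} * measure P {u<..w}"
      using ratio_gap[of u w v b] that by (simp add: mult.commute)
    finally show ?thesis using p by simp
  qed
  have stP: "c * measure P {s<..t} < measure N {s<..t}"
  proof -
    have "measure P {s<..t} > 0"
      using st c0 by (auto simp: zero_less_measure_iff)
    then show ?thesis using st(3) by (simp add: less_divide_eq)
  qed
  \<comment> \<open>If the witness \<open>{s<..t}\<close> ends at \<open>x\<close>, the quotient at a possible atom in \<open>x\<close> is reached by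
    intervals \<open>{u<..b}\<close> with \<open>u\<close> tending to \<open>x\<close> from the left: either \<open>{s<..u}\<close> is again a witness,
    or the surplus of \<open>{s<..t}\<close> over \<open>c\<close> lies in \<open>{u<..x}\<close>.\<close>
  define s' where "s' = (if t < x then t else s)"
  have "s' < x" unfolding s'_def using st by auto
  have Ioc': "c * measure P {u<..b} \<le> measure N {u<..b}" if u: "s' < u" "u < x" and b: "x \<le> b" for u b
  proof (cases "t < x")
    case True
    then show ?thesis using Ioc[of s t u b] u b st stP unfolding s'_def by auto
  next
    case False
    then have t: "t = x" using st by simp
    have su: "s < u" using u t by (simp add: s'_def)
    show ?thesis
    proof (cases "c * measure P {s<..u} < measure N {s<..u}")
      case True
      then show ?thesis using Ioc[of s u u b] u b su by auto
    next
      case False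
      have "c * measure P {x<..b} \<le> measure N {x<..b}"
        using Ioc[of s t x b] st stP t b by (cases "x = b") auto
      moreover have "c * measure P {u<..x} \<le> measure N {u<..x}"
        using False stP measure_Ioc_split[of s u x] su u t by (simp add: distrib_left)
      ultimately show ?thesis
        using measure_Ioc_split[of u x b] u b by (simp add: distrib_left)
    qed
  qed
  have Icc: "c * measure P {x..b} \<le> measure N {x..b}" if "x \<le> b" for b
  proof -
    have "{..b} = {..<x} \<union> {x..b}" using that by auto
    then have e: "measure P {x..b} = cdf P b - measure P {..<x}"
      "measure N {x..b} = cdf N b - measure N {..<x}"
      unfolding cdf_def using P.finite_measure_Union[of "{..<x}" "{x..b}"]
        N.finite_measure_Union[of "{..<x}" "{x..b}"] P.M_is_borel N.M_is_borel
      by (auto simp: disjoint_iff)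
    \<comment> \<open>As \<open>u\<close> tends to \<open>x\<close> from the left, the distribution
      functions at \<open>u\<close> tend to the masses of \<open>{..<x}\<close>, so the limit of the
      inequalities on \<open>{u<..b}\<close> is the one on \<open>{x..b}\<close>, atom
      included.\<close>
    have "eventually (\<lambda>u. c * (cdf P b - cdf P u) \<le> cdf N b - cdf N u) (at_left x)"
      using eventually_at_left_real[OF \<open>s' < x\<close>]
    proof eventually_elim
      case (elim u)
      then show ?case
        using Ioc'[of u b] that P.cdf_diff_eq[of u b] N.cdf_diff_eq[of u b] by auto
    qed
    then show ?thesis unfolding e
      by (intro tendsto_le[OF _ _ _ \<open>eventually _ _\<close>] tendsto_intros P.cdf_at_left N.cdf_at_left) auto
  qed
  have "c * measure P ({a<..b} \<inter> {x..}) \<le> measure N ({a<..b} \<inter> {x..})" if "a < b" for a b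
  proof -
    consider "x \<le> a" | "a < x" "x \<le> b" | "b < x" by linarith
    then show ?thesis
    proof cases
      case 1
      then have "{a<..b} \<inter> {x..} = {a<..b}" by auto
      then show ?thesis using Ioc[of s t a b] 1 that st stP by simp
    next
      case 2
      then have "{a<..b} \<inter> {x..} = {x..b}" by auto
      then show ?thesis using Icc[of b] 2 by simp
    next
      case 3
      then have "{a<..b} \<inter> {x..} = {}" by auto
      then show ?thesis by simp
    qed
  qed
  then have "c * measure P A \<le> measure N A"
    using finite_borel_measure_le_of_Ioc_on[of P N "{x..}" c 1 A] A c0
      N.finite_borel_measure_axioms P.finite_borel_measure_axioms by simp
  then show False using c(1) PA by (simp add: divide_less_eq)
qed

section \<open>Level sets and the density\<close>

text \<open>\<open>N_le_g_P\<close> at the supremum of \<open>A\<close> would not do: that point may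
  be infinite or lie outside \<open>A\<close>, and \<open>g\<close> may jump above \<open>v\<close>
  there. So \<open>A\<close> is exhausted by its parts up to points \<open>x n\<close> of
  \<open>A\<close>, where \<open>g\<close> is at most \<open>v\<close>.\<close>

lemma N_le_level:
  assumes A: "A \<in> sets borel" and v: "\<And>x. x \<in> A \<Longrightarrow> g x \<le> v"
  shows "measure N A \<le> v * measure P A"
proof (cases "A = {}")
  case False
  then obtain x where x: "incseq x" "range x \<subseteq> A" "\<And>s. s \<in> A \<Longrightarrow> \<exists>n::nat. s \<le> x n"
    by (rule cofinal_incseq) blast
  have U: "(\<Union>n. A \<inter> {..x n}) = A" using x(3) by blast
  have inc: "incseq (\<lambda>n. A \<inter> {..x n})"
    using x(1) by (fastforce simp: incseq_def intro: order_trans)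
  have R: "range (\<lambda>n. A \<inter> {..x n}) \<subseteq> sets N" "range (\<lambda>n. A \<inter> {..x n}) \<subseteq> sets P"
    using A by (auto simp: N.M_is_borel P.M_is_borel)
  have "(\<lambda>n. measure N (A \<inter> {..x n})) \<longlonglongrightarrow> measure N A"
    using N.finite_Lim_measure_incseq[OF R(1) inc] unfolding U .
  moreover have "(\<lambda>n. v * measure P (A \<inter> {..x n})) \<longlonglongrightarrow> v * measure P A"
    using P.finite_Lim_measure_incseq[OF R(2) inc] unfolding U by (intro tendsto_intros)
  moreover have "measure N (A \<inter> {..x n}) \<le> v * measure P (A \<inter> {..x n})" for n
  proof -
    have "measure N (A \<inter> {..x n}) \<le> g (x n) * measure P (A \<inter> {..x n})"
      using A by (intro N_le_g_P) auto
    also have "\<dots> \<le> v * measure P (A \<inter> {..x n})"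
      using x(2) by (intro mult_right_mono v) auto
    finally show ?thesis .
  qed
  ultimately show ?thesis by (intro LIMSEQ_le) auto
qed simp

lemma level_le_N:
  assumes A: "A \<in> sets borel" and u: "\<And>x. x \<in> A \<Longrightarrow> u \<le> g x"
  shows "u * measure P A \<le> measure N A"
proof (cases "A = {}")
  case False
  then obtain x where x: "decseq x" "range x \<subseteq> A" "\<And>s. s \<in> A \<Longrightarrow> \<exists>n::nat. x n \<le> s"
    by (rule cofinal_decseq) blast
  have U: "(\<Union>n. A \<inter> {x n..}) = A" using x(3) by blast
  have inc: "incseq (\<lambda>n. A \<inter> {x n..})"
    using x(1) by (fastforce simp: incseq_def decseq_def intro: order_trans)
  have R: "range (\<lambda>n. A \<inter> {x n..}) \<subseteq> sets N" "range (\<lambda>n. A \<inter> {x n..}) \<subseteq> sets P"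
    using A by (auto simp: N.M_is_borel P.M_is_borel)
  have "(\<lambda>n. measure N (A \<inter> {x n..})) \<longlonglongrightarrow> measure N A"
    using N.finite_Lim_measure_incseq[OF R(1) inc] unfolding U .
  moreover have "(\<lambda>n. u * measure P (A \<inter> {x n..})) \<longlonglongrightarrow> u * measure P A"
    using P.finite_Lim_measure_incseq[OF R(2) inc] unfolding U by (intro tendsto_intros)
  moreover have "u * measure P (A \<inter> {x n..}) \<le> measure N (A \<inter> {x n..})" for n
  proof -
    have "u * measure P (A \<inter> {x n..}) \<le> g (x n) * measure P (A \<inter> {x n..})"
      using x(2) by (intro mult_right_mono u) auto
    also have "\<dots> \<le> measure N (A \<inter> {x n..})"
      using A by (intro g_P_le_N) auto
    finally show ?thesis .
  qed
  ultimately show ?thesis by (intro LIMSEQ_le) auto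
qed simp

lemma integrable_g: "A \<in> sets borel \<Longrightarrow> set_integrable P A g"
  unfolding set_integrable_def using g_nonneg g_le_1 P.M_is_borel
  by (intro P.integrable_const_bound[of _ 1])
    (auto simp: measurable_cong_sets[OF P.M_is_borel refl] split: split_indicator)

lemma integral_g_bounds:
  assumes A: "A \<in> sets borel" and "\<And>x. x \<in> A \<Longrightarrow> u \<le> g x" "\<And>x. x \<in> A \<Longrightarrow> g x \<le> v"
  shows "u * measure P A \<le> (LINT x:A|P. g x)" "(LINT x:A|P. g x) \<le> v * measure P A"
proof -
  have "integrable P (indicat_real A)"
    using A P.M_is_borel by (intro integrable_real_indicator) (auto simp: P.emeasure_eq_measure)
  then have c: "set_integrable P A (\<lambda>x. c)" "(LINT x:A|P. c) = c * measure P A" for c :: real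
    using A P.M_is_borel by (auto simp: set_integrable_def set_lebesgue_integral_def)
  show "u * measure P A \<le> (LINT x:A|P. g x)"
    using set_integral_mono[OF c(1)[of u] integrable_g[OF A]] assms c by simp
  show "(LINT x:A|P. g x) \<le> v * measure P A"
    using set_integral_mono[OF integrable_g[OF A] c(1)[of v]] assms c by simp
qed

text \<open>On a slice where \<open>g\<close> varies by at most \<open>1 / n\<close>, both sides lie
  between the same two multiples of the \<open>P\<close>-measure of the slice. Summing gives a
  difference of at most \<open>measure P A / n\<close>.\<close>

lemma N_eq_integral_g:
  assumes A: "A \<in> sets borel"
  shows "measure N A = (LINT x:A|P. g x)"
proof -
  have "\<bar>measure N A - (LINT x:A|P. g x)\<bar> \<le> measure P A / real n" if n: "n > 0" for n :: nat
  proof -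
    \<comment> \<open>On \<open>S j\<close> the values of \<open>g\<close> lie in the interval from
      \<open>(j - 1) / n\<close>, exclusive, to \<open>j / n\<close>, inclusive. Since
      \<open>g\<close> takes values in [0,1], the indices 0 to \<open>n\<close> suffice, and
      \<open>S 0\<close> is where \<open>g\<close> vanishes.\<close>
    define S where "S j = A \<inter> {x. \<lceil>real n * g x\<rceil> = int j}" for j :: nat
    have S[measurable]: "S j \<in> sets borel" for j
      unfolding S_def using A by measurable
    have gS: "(real j - 1) / n \<le> g x" "g x \<le> real j / n" if "x \<in> S j" for x j
      using that ceiling_correct[of "real n * g x"] n unfolding S_def
      by (auto simp: field_simps)
    have AS: "A = (\<Union>j\<in>{..n}. S j)"
    proof -
      have "\<lceil>real n * g x\<rceil> = int (nat \<lceil>real n * g x\<rceil>)" "nat \<lceil>real n * g x\<rceil> \<le> n" for x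
      proof -
        have "0 \<le> real n * g x" using g_nonneg by simp
        then show "\<lceil>real n * g x\<rceil> = int (nat \<lceil>real n * g x\<rceil>)" by simp
        have "real n * g x \<le> real n" using g_le_1[of x] by (simp add: mult_left_le)
        then show "nat \<lceil>real n * g x\<rceil> \<le> n" by (simp add: nat_le_iff ceiling_le_iff)
      qed
      then show ?thesis unfolding S_def by blast
    qed
    have disj: "disjoint_family_on S {..n}"
      unfolding disjoint_family_on_def S_def by auto
    have R: "S ` {..n} \<subseteq> sets N" "S ` {..n} \<subseteq> sets P"
      using S by (auto simp: N.M_is_borel P.M_is_borel)
    have N: "measure N A = (\<Sum>j\<le>n. measure N (S j))"
      using N.finite_measure_finite_Union[OF finite_atMost R(1) disj] unfolding AS[symmetric] .
    have P: "measure P A = (\<Sum>j\<le>n. measure P (S j))"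
      using P.finite_measure_finite_Union[OF finite_atMost R(2) disj] unfolding AS[symmetric] .
    have "(LINT x:(\<Union>j\<in>{..n}. S j)|P. g x) = (\<Sum>j\<le>n. LINT x:S j|P. g x)"
      by (rule set_integral_finite_Union[OF finite_atMost disj integrable_g[OF S]])
        (simp add: P.M_is_borel)
    then have I: "(LINT x:A|P. g x) = (\<Sum>j\<le>n. LINT x:S j|P. g x)"
      unfolding AS[symmetric] .
    have "\<bar>measure N (S j) - (LINT x:S j|P. g x)\<bar> \<le> measure P (S j) / n" for j
    proof -
      have "measure N (S j) \<le> real j / n * measure P (S j)"
        by (rule N_le_level[OF S gS(2)])
      moreover have "(real j - 1) / n * measure P (S j) \<le> measure N (S j)"
        by (rule level_le_N[OF S gS(1)])
      moreover have "(real j - 1) / n * measure P (S j) \<le> (LINT x:S j|P. g x)"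
        "(LINT x:S j|P. g x) \<le> real j / n * measure P (S j)"
        by (rule integral_g_bounds[OF S gS], assumption, assumption)+
      ultimately show ?thesis by (simp add: diff_divide_distrib left_diff_distrib abs_le_iff)
    qed
    then have "\<bar>\<Sum>j\<le>n. measure N (S j) - (LINT x:S j|P. g x)\<bar> \<le> (\<Sum>j\<le>n. measure P (S j) / n)"
      by (intro order_trans[OF sum_abs] sum_mono)
    then show ?thesis unfolding N P I by (simp add: sum_subtractf sum_divide_distrib)
  qed
  then have "eventually (\<lambda>n. \<bar>measure N A - (LINT x:A|P. g x)\<bar> \<le> measure P A / real n) sequentially"
    by (intro eventually_mono[OF eventually_gt_at_top[of "0::nat"]])
  then have "\<bar>measure N A - (LINT x:A|P. g x)\<bar> \<le> 0"
    by (rule tendsto_lowerbound[OF lim_const_over_n]) simp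
  then show ?thesis by simp
qed

end

section \<open>Stochastically increasing kernels\<close>

text \<open>This is the range of a random variable expressed through its law;
  \<open>distr_range_P\<close> identifies it with \<open>rv_range\<close>.\<close>

definition distr_range :: "real measure \<Rightarrow> real set" where
  "distr_range P = {x. 0 < measure P {..x} \<and> 0 < measure P {x..}}"

lemma (in finite_borel_measure) distr_range_measurable [measurable]: "distr_range M \<in> sets borel"
proof -
  have "mono (\<lambda>x. measure M {..x})"
    using cdf_nondecreasing unfolding mono_def cdf_def by blast
  then have [measurable]: "(\<lambda>x. measure M {..x}) \<in> borel_measurable borel"
    by (rule borel_measurable_mono)
  have "mono (\<lambda>x. - measure M {x..})"
    by (intro monoI le_imp_neg_le finite_measure_mono sets_M) simp_all
  then have "(\<lambda>x. - measure M {x..}) \<in> borel_measurable borel"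
    by (rule borel_measurable_mono)
  then have [measurable]: "(\<lambda>x. measure M {x..}) \<in> borel_measurable borel"
    by (subst (asm) borel_measurable_uminus_eq)
  show ?thesis unfolding distr_range_def by measurable
qed

text \<open>A point outside the range has a null half-line on one of its sides, and each of the two
  kinds of points is covered by one null set.\<close>

lemma (in finite_borel_measure) AE_distr_range: "AE x in M. x \<in> distr_range M"
proof -
  obtain N1 where N1: "{x. measure M {..x} = 0} \<subseteq> N1" "N1 \<in> null_sets M"
    by (rule null_downset[of "{x. measure M {..x} = 0}"]) auto
  obtain N2 where N2: "{x. measure M {x..} = 0} \<subseteq> N2" "N2 \<in> null_sets M"
    by (rule null_upset[of "{x. measure M {x..} = 0}"]) auto
  show ?thesis
    using N1 N2 by (intro AE_I'[of "N1 \<union> N2"]) (auto simp: distr_range_def zero_less_measure_iff)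
qed

text \<open>For each fixed Borel set \<open>A\<close>, the assumptions on y make
  \<open>measure (N y) A\<close> the upper tail function of a finite measure with total mass
  \<open>measure P A\<close>.\<close>

locale increasing_ratio_family =
  fixes P :: "real measure" and N :: "real \<Rightarrow> real measure"
  assumes increasing_ratio: "increasing_ratio P (N y)"
    and N_antimono: "y \<le> z \<Longrightarrow> A \<in> sets borel \<Longrightarrow> measure (N z) A \<le> measure (N y) A"
    and N_right_cont: "A \<in> sets borel \<Longrightarrow> ((\<lambda>z. measure (N z) A) \<longlongrightarrow> measure (N y) A) (at_right y)"
    and N_at_bot: "A \<in> sets borel \<Longrightarrow> ((\<lambda>y. measure (N y) A) \<longlongrightarrow> measure P A) at_bot"
    and N_at_top: "A \<in> sets borel \<Longrightarrow> ((\<lambda>y. measure (N y) A) \<longlongrightarrow> 0) at_top"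
begin

sublocale P: finite_borel_measure P
  using increasing_ratio[of 0] by (simp add: increasing_ratio_def)

definition G :: "real \<Rightarrow> real \<Rightarrow> real" where
  "G y x = left_ratio_sup P (N y) x"

lemma G_antimono: "y \<le> z \<Longrightarrow> G z x \<le> G y x"
  unfolding G_def left_ratio_sup_def
  by (rule cSUP_mono[OF increasing_ratio.intervals_ne[OF increasing_ratio]
      increasing_ratio.bdd_above_quotients[OF increasing_ratio]], erule bexI[rotated])
    (auto intro!: divide_right_mono N_antimono)

lemma G_mono: "x \<le> x' \<Longrightarrow> G y x \<le> G y x'"
  unfolding G_def using increasing_ratio.mono_g[OF increasing_ratio] by (rule monoD)

lemma G_bounds: "0 \<le> G y x" "G y x \<le> 1"
  unfolding G_def using increasing_ratio.g_nonneg[OF increasing_ratio]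
    increasing_ratio.g_le_1[OF increasing_ratio] by auto

text \<open>A decreasing function can fail right-continuity only by dropping. A single quotient that
  exceeds \<open>a\<close> at \<open>y\<close> still does so slightly to the right, and the supremum
  stays above it.\<close>

lemma G_right_cont: "continuous (at_right y) (\<lambda>y. G y x)"
  unfolding continuous_within
proof (rule order_tendstoI)
  fix a assume "a < G y x"
  then obtain s t where st: "s < t" "t \<le> x" "a < measure (N y) {s<..t} / measure P {s<..t}"
    unfolding G_def left_ratio_sup_def
    by (subst (asm) less_cSUP_iff[OF increasing_ratio.intervals_ne[OF increasing_ratio]
          increasing_ratio.bdd_above_quotients[OF increasing_ratio]]) auto
  have "((\<lambda>z. measure (N z) {s<..t} / measure P {s<..t}) \<longlongrightarrow>
    measure (N y) {s<..t} / measure P {s<..t}) (at_right y)"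
    unfolding divide_inverse by (intro tendsto_intros N_right_cont) simp
  from order_tendstoD(1)[OF this st(3)] show "eventually (\<lambda>z. a < G z x) (at_right y)"
  proof eventually_elim
    case (elim z)
    then show ?case
      using increasing_ratio.quotient_le_g[OF increasing_ratio[of z] st(1,2)] unfolding G_def by linarith
  qed
next
  fix a assume "G y x < a"
  then show "eventually (\<lambda>z. G z x < a) (at_right y)"
    by (intro eventually_mono[OF eventually_at_right_less[of y]])
      (rule le_less_trans[OF G_antimono[OF less_imp_le]])
qed

text \<open>The quotient for \<open>{..x}\<close> is a lower bound tending to 1. Membership in the
  range makes its denominator positive; \<open>G_at_top\<close> uses \<open>{x..}\<close> in the
  same way.\<close>

lemma G_at_bot:
  assumes "x \<in> distr_range P"
  shows "((\<lambda>y. G y x) \<longlongrightarrow> 1) at_bot"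
proof (rule tendsto_sandwich[of "\<lambda>y. measure (N y) {..x} / measure P {..x}"])
  have p: "measure P {..x} > 0" using assms by (simp add: distr_range_def)
  have "measure (N y) {..x} \<le> G y x * measure P {..x}" for y
    unfolding G_def by (rule increasing_ratio.N_le_g_P[OF increasing_ratio]) auto
  then show "eventually (\<lambda>y. measure (N y) {..x} / measure P {..x} \<le> G y x) at_bot"
    using p by (simp add: divide_le_eq)
  have "((\<lambda>y. measure (N y) {..x} / measure P {..x}) \<longlongrightarrow> measure P {..x} / measure P {..x}) at_bot"
    unfolding divide_inverse by (intro tendsto_intros N_at_bot) simp
  then show "((\<lambda>y. measure (N y) {..x} / measure P {..x}) \<longlongrightarrow> 1) at_bot"
    using p by simp
qed (auto simp: G_bounds)

lemma G_at_top:
  assumes "x \<in> distr_range P"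
  shows "((\<lambda>y. G y x) \<longlongrightarrow> 0) at_top"
proof (rule tendsto_sandwich[where f = "\<lambda>_. 0" and h = "\<lambda>y. measure (N y) {x..} / measure P {x..}"])
  have p: "measure P {x..} > 0" using assms by (simp add: distr_range_def)
  have "G y x * measure P {x..} \<le> measure (N y) {x..}" for y
    unfolding G_def by (rule increasing_ratio.g_P_le_N[OF increasing_ratio]) auto
  then show "eventually (\<lambda>y. G y x \<le> measure (N y) {x..} / measure P {x..}) at_top"
    using p by (simp add: le_divide_eq)
  have "((\<lambda>y. measure (N y) {x..} / measure P {x..}) \<longlongrightarrow> 0 / measure P {x..}) at_top"
    unfolding divide_inverse by (intro tendsto_intros N_at_top) simp
  then show "((\<lambda>y. measure (N y) {x..} / measure P {x..}) \<longlongrightarrow> 0) at_top" by simp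
qed (auto simp: G_bounds)

section \<open>The kernel\<close>

definition K :: "real \<Rightarrow> real measure" where
  "K x = (if x \<in> distr_range P then interval_measure (\<lambda>y. 1 - G y x) else return borel 0)"

lemma real_distribution_K: "real_distribution (K x)"
proof (cases "x \<in> distr_range P")
  case True
  have "((\<lambda>y. 1 - G y x) \<longlongrightarrow> 1 - 1) at_bot" "((\<lambda>y. 1 - G y x) \<longlongrightarrow> 1 - 0) at_top"
    by (intro tendsto_intros G_at_bot G_at_top True)+
  then show ?thesis
    unfolding K_def using True G_antimono
    by (auto intro!: real_distribution_interval_measure continuous_intros G_right_cont)
next
  case False
  then show ?thesis
    unfolding K_def real_distribution_def real_distribution_axioms_def
    by (auto intro!: prob_space_return)
qed

lemma prob_space_K: "prob_space (K x)"
  using real_distribution_K[of x] by (simp add: real_distribution_def)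

lemma sets_K: "sets (K x) = sets borel"
  using real_distribution.events_eq_borel[OF real_distribution_K] .

lemma measure_K_atMost: "x \<in> distr_range P \<Longrightarrow> measure (K x) {..y} = 1 - G y x"
  using emeasure_interval_measure_Iic[of "\<lambda>y. 1 - G y x" y] G_antimono G_right_cont
    tendsto_diff[OF tendsto_const[of 1] G_at_bot[of x]] G_bounds[of y x]
  by (simp add: K_def measure_def continuous_intros)

lemma measure_K_greaterThan:
  assumes "x \<in> distr_range P"
  shows "measure (K x) {y<..} = G y x"
proof -
  interpret real_distribution "K x" by (rule real_distribution_K)
  have "{y<..} = UNIV - {..y}" by auto
  then show ?thesis
    using prob_compl[of "{..y}"] measure_K_atMost[OF assms] by simp
qed

text \<open>It suffices to test the half-lines \<open>{..y}\<close>, where \<open>K\<close> has mass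
  \<open>1 - G y x\<close> on the range, monotone in x, and constant mass off the range.\<close>

lemma K_measurable: "K \<in> borel \<rightarrow>\<^sub>M prob_algebra borel"
proof (rule measurable_prob_algebra_generated[where \<Omega> = UNIV and G = "range (\<lambda>y::real. {..y})"])
  show "sets borel = sigma_sets UNIV (range (\<lambda>y::real. {..y}))"
    unfolding borel_eq_atMost by (subst sets_measure_of) auto
  show "Int_stable (range (\<lambda>y::real. {..y}))" by (auto simp: Int_stable_def)
  fix A assume "A \<in> range (\<lambda>y::real. {..y})"
  then obtain y where A: "A = {..y}" by auto
  have "mono (G y)" using G_mono by (rule monoI)
  then have [measurable]: "G y \<in> borel_measurable borel" by (rule borel_measurable_mono)
  have "emeasure (K x) A = (if x \<in> distr_range P then ennreal (1 - G y x) else indicator A 0)" for x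
  proof (cases "x \<in> distr_range P")
    case True
    interpret real_distribution "K x" by (rule real_distribution_K)
    show ?thesis using True measure_K_atMost[OF True, of y] A by (simp add: emeasure_eq_measure)
  next
    case False
    then show ?thesis using A by (simp add: K_def)
  qed
  then show "(\<lambda>x. emeasure (K x) A) \<in> borel_measurable borel" by simp
qed (auto simp: prob_space_K sets_K)

lemma stoch_le_K: "x \<in> distr_range P \<Longrightarrow> x' \<in> distr_range P \<Longrightarrow> x \<le> x' \<Longrightarrow> stoch_le (K x) (K x')"
  unfolding stoch_le_def by (simp add: measure_K_greaterThan G_mono)

lemma measure_N_eq_integral_K:
  assumes A: "A \<in> sets borel"
  shows "measure (N y) A = (LINT x:A|P. measure (K x) {y<..})"
proof -
  have [measurable_cong]: "sets P = sets borel" by (rule P.M_is_borel)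
  have [measurable]: "(\<lambda>x. measure (K x) {y<..}) \<in> borel_measurable borel"
    by (rule measurable_compose[OF K_measurable measurable_measure_prob_algebra]) simp
  have "mono (G y)" using G_mono by (rule monoI)
  then have [measurable]: "G y \<in> borel_measurable borel" by (rule borel_measurable_mono)
  have "measure (N y) A = (LINT x:A|P. G y x)"
    unfolding G_def by (rule increasing_ratio.N_eq_integral_g[OF increasing_ratio A])
  also have "\<dots> = (LINT x:A|P. measure (K x) {y<..})"
    unfolding set_lebesgue_integral_def using A P.AE_distr_range
    by (intro integral_cong_AE) (auto simp: measure_K_greaterThan elim: eventually_mono)
  finally show ?thesis .
qed

end

section \<open>Joint distributions\<close>

text \<open>A negative value at \<open>x\<close> would persist on an interval to the right, which
  meets \<open>D\<close>. The bound \<open>b\<close> lets \<open>x\<close> be approached without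
  crossing a neighbouring endpoint.\<close>

lemma nonneg_of_dense_right:
  fixes f :: "real \<Rightarrow> real"
  assumes D: "closure D = UNIV" and f: "continuous (at_right x) f" and "x < b"
    and nonneg: "\<And>d. d \<in> D \<Longrightarrow> x < d \<Longrightarrow> d < b \<Longrightarrow> 0 \<le> f d"
  shows "0 \<le> f x"
proof (rule ccontr)
  assume "\<not> 0 \<le> f x"
  then have "eventually (\<lambda>z. f z < 0) (at_right x)"
    using f unfolding continuous_within by (intro order_tendstoD(2)) auto
  then obtain c where c: "x < c" "\<And>z. x < z \<Longrightarrow> z < c \<Longrightarrow> f z < 0"
    unfolding eventually_at_right_field by auto
  have "{x<..<min b c} \<noteq> {}" using c(1) \<open>x < b\<close> by simp
  then have "{x<..<min b c} \<inter> D \<noteq> {}"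
    using open_Int_closure_eq_empty[of "{x<..<min b c}" D] D by auto
  then show False using c(2) nonneg by fastforce
qed

locale joint_law = prob_space M for M :: "'a measure" +
  fixes X Y :: "'a \<Rightarrow> real"
  assumes X[measurable]: "X \<in> borel_measurable M" and Y[measurable]: "Y \<in> borel_measurable M"
begin

definition R where "R = distr M (borel \<Otimes>\<^sub>M borel) (\<lambda>\<omega>. (X \<omega>, Y \<omega>))"
definition P where "P = distr M borel X"
text \<open>\<open>N y\<close> is \<open>A \<mapsto> R (A \<times> {y<..})\<close> and \<open>H A\<close> is \<open>B \<mapsto> R (A \<times> B)\<close>.\<close>

definition N where "N y = distr (restrict_space M {\<omega>\<in>space M. y < Y \<omega>}) borel X"
definition H where "H A = distr (restrict_space M {\<omega>\<in>space M. X \<omega> \<in> A}) borel Y"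

lemma measure_R:
  "A \<in> sets borel \<Longrightarrow> B \<in> sets borel \<Longrightarrow> measure R (A \<times> B) = prob {\<omega>\<in>space M. X \<omega> \<in> A \<and> Y \<omega> \<in> B}"
  unfolding R_def by (subst measure_distr) (auto intro!: arg_cong[where f=prob])

lemma measure_P: "A \<in> sets borel \<Longrightarrow> measure P A = prob {\<omega>\<in>space M. X \<omega> \<in> A}"
  unfolding P_def by (subst measure_distr) (auto intro!: arg_cong[where f=prob])

lemma measure_N:
  assumes [measurable]: "A \<in> sets borel"
  shows "measure (N y) A = measure R (A \<times> {y<..})"
proof -
  have "measure (N y) A = measure (restrict_space M {\<omega>\<in>space M. y < Y \<omega>})
      {\<omega>\<in>space M. X \<omega> \<in> A \<and> Y \<omega> \<in> {y<..}}"
    unfolding N_def by (subst measure_distr)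
      (auto intro!: arg_cong[where f="measure _"] measurable_restrict_space1 simp: space_restrict_space)
  also have "\<dots> = measure R (A \<times> {y<..})"
    by (subst measure_restrict_space) (auto simp: measure_R)
  finally show ?thesis .
qed

lemma measure_H:
  assumes [measurable]: "A \<in> sets borel" "B \<in> sets borel"
  shows "measure (H A) B = measure R (A \<times> B)"
proof -
  have "measure (H A) B = measure (restrict_space M {\<omega>\<in>space M. X \<omega> \<in> A})
      {\<omega>\<in>space M. X \<omega> \<in> A \<and> Y \<omega> \<in> B}"
    unfolding H_def by (subst measure_distr)
      (auto intro!: arg_cong[where f="measure _"] measurable_restrict_space1 simp: space_restrict_space)
  also have "\<dots> = measure R (A \<times> B)"
    by (subst measure_restrict_space) (auto simp: measure_R)
  finally show ?thesis .
qed

lemma finite_borel_measure_P: "finite_borel_measure P"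
  unfolding P_def using real_distribution_distr[OF X]
  by (rule real_distribution.finite_borel_measure_M)

lemma finite_borel_measure_distr_restrict:
  assumes [measurable]: "E \<in> sets M" "Z \<in> borel_measurable M"
  shows "finite_borel_measure (distr (restrict_space M E) borel Z)"
proof -
  interpret r: finite_measure "restrict_space M E"
    by (rule finite_measure_restrict_space) auto
  have "finite_measure (distr (restrict_space M E) borel Z)"
    by (rule r.finite_measure_distr) (auto intro: measurable_restrict_space1)
  then show ?thesis
    by (intro finite_borel_measure.intro finite_borel_measure_axioms.intro) simp_all
qed

lemma finite_borel_measure_N: "finite_borel_measure (N y)"
  unfolding N_def by (rule finite_borel_measure_distr_restrict) auto

lemma finite_borel_measure_H:
  assumes [measurable]: "A \<in> sets borel"
  shows "finite_borel_measure (H A)"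
  unfolding H_def by (rule finite_borel_measure_distr_restrict) auto

lemma distr_range_P: "distr_range P = rv_range M X"
  unfolding distr_range_def rv_range_def by (simp add: measure_P)

lemma measure_R_le_P:
  "A \<in> sets borel \<Longrightarrow> B \<in> sets borel \<Longrightarrow> measure R (A \<times> B) \<le> measure P A"
  by (auto simp: measure_R measure_P intro!: finite_measure_mono)

lemma measure_H_UNIV: "A \<in> sets borel \<Longrightarrow> measure (H A) UNIV = measure P A"
  by (simp add: measure_H measure_R measure_P)

text \<open>For fixed \<open>A\<close> the dependence on \<open>y\<close> is that of one
  distribution function, which supplies monotonicity, right-continuity and both limits in
  \<open>y\<close>.\<close>

lemma measure_N_eq_cdf_H:
  assumes A: "A \<in> sets borel"
  shows "measure (N y) A = measure P A - cdf (H A) y"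
proof -
  interpret H: finite_borel_measure "H A" by (rule finite_borel_measure_H[OF A])
  have "{y<..} = UNIV - {..y}" by auto
  then have "measure (H A) {y<..} = measure (H A) UNIV - measure (H A) {..y}"
    using H.finite_measure_compl[of "{..y}"] by (simp add: H.borel_UNIV H.M_is_borel)
  then show ?thesis using A measure_H_UNIV[OF A] by (simp add: measure_N measure_H cdf_def)
qed

section \<open>From the dense set to all intervals\<close>

lemma increasing_ratio_of_dense:
  assumes D: "closure D = UNIV"
    and ineq: "\<And>a b c y. a \<in> D \<Longrightarrow> b \<in> D \<Longrightarrow> c \<in> D \<Longrightarrow> y \<in> D \<Longrightarrow> a < b \<Longrightarrow> b < c \<Longrightarrow>
      order_ineq R P {a<..b} {b<..c} y"
  shows "increasing_ratio P (N y)"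
proof -
  interpret P: finite_borel_measure P by (rule finite_borel_measure_P)
  interpret N: finite_borel_measure "N t" for t by (rule finite_borel_measure_N)
  \<comment> \<open>Right side minus left side of the inequality, written with distribution
    functions so that it is right-continuous in each of its four arguments separately.\<close>
  define \<psi> where "\<psi> a b c y = (cdf P b - cdf P a) * (cdf (N y) c - cdf (N y) b)
    - (cdf (N y) b - cdf (N y) a) * (cdf P c - cdf P b)" for a b c y
  have \<psi>: "0 \<le> \<psi> a b c y \<longleftrightarrow> order_ineq R P {a<..b} {b<..c} y" if "a < b" "b < c" for a b c y
    unfolding \<psi>_def order_ineq_def using that
    by (simp add: P.cdf_diff_eq N.cdf_diff_eq measure_N)
  have cont_y: "continuous (at_right y) (\<lambda>y. cdf (N y) t)" for t y
    unfolding cdf_def[of "N _"] measure_N_eq_cdf_H[OF atMost_borel]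
    by (intro continuous_intros finite_borel_measure.cdf_is_right_cont[OF finite_borel_measure_H]) simp
  note cont = P.cdf_is_right_cont N.cdf_is_right_cont cont_y
  \<comment> \<open>The arguments are released from \<open>D\<close> one at a time, in the order
    \<open>y\<close>, \<open>c\<close>, \<open>b\<close>, \<open>a\<close>. When \<open>b\<close> is
    approached from the right it must stay below \<open>c\<close>, and \<open>a\<close> below
    \<open>b\<close>.\<close>
  have 1: "0 \<le> \<psi> a b c y" if "a \<in> D" "b \<in> D" "c \<in> D" "a < b" "b < c" for a b c y
  proof (rule nonneg_of_dense_right[OF D, of y "\<lambda>y. \<psi> a b c y" "y + 1"])
    show "continuous (at_right y) (\<psi> a b c)"
      unfolding \<psi>_def by (intro continuous_intros cont)
  qed (use that ineq \<psi> in auto)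
  have 2: "0 \<le> \<psi> a b c y" if "a \<in> D" "b \<in> D" "a < b" "b < c" for a b c y
  proof (rule nonneg_of_dense_right[OF D, of c "\<lambda>c. \<psi> a b c y" "c + 1"])
    show "continuous (at_right c) (\<lambda>c. \<psi> a b c y)"
      unfolding \<psi>_def by (intro continuous_intros cont)
  qed (use that 1 in auto)
  have 3: "0 \<le> \<psi> a b c y" if "a \<in> D" "a < b" "b < c" for a b c y
  proof (rule nonneg_of_dense_right[OF D, of b "\<lambda>b. \<psi> a b c y" c])
    show "continuous (at_right b) (\<lambda>b. \<psi> a b c y)"
      unfolding \<psi>_def by (intro continuous_intros cont)
  qed (use that 2 in auto)
  have 4: "0 \<le> \<psi> a b c y" if "a < b" "b < c" for a b c y
  proof (rule nonneg_of_dense_right[OF D, of a "\<lambda>a. \<psi> a b c y" b])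
    show "continuous (at_right a) (\<lambda>a. \<psi> a b c y)"
      unfolding \<psi>_def by (intro continuous_intros cont)
  qed (use that 3 in auto)
  have "measure (N y) A \<le> measure P A" if "A \<in> sets borel" for A
    using that by (simp add: measure_N measure_R_le_P)
  moreover have "measure (N y) {a<..b} * measure P {b<..c} \<le> measure P {a<..b} * measure (N y) {b<..c}"
    if "a < b" "b < c" for a b c
    using 4[OF that, of y] unfolding \<psi>[OF that] order_ineq_def by (simp add: measure_N)
  ultimately have "increasing_ratio_axioms P (N y)"
    by (rule increasing_ratio_axioms.intro)
  then show ?thesis
    by (simp add: increasing_ratio_def finite_borel_measure_P finite_borel_measure_N)
qed

lemma increasing_ratio_familyI:
  assumes "\<And>y. increasing_ratio P (N y)"
  shows "increasing_ratio_family P N"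
proof -
  have *: "((\<lambda>z. measure (N z) A) \<longlongrightarrow> measure (N y) A) (at_right y)"
    "((\<lambda>y. measure (N y) A) \<longlongrightarrow> measure P A) at_bot"
    "((\<lambda>y. measure (N y) A) \<longlongrightarrow> 0) at_top"
    "y \<le> z \<Longrightarrow> measure (N z) A \<le> measure (N y) A"
    if A: "A \<in> sets borel" for A y z
  proof -
    interpret H: finite_borel_measure "H A" by (rule finite_borel_measure_H[OF A])
    have "measure (H A) (space (H A)) = measure P A"
      using measure_H_UNIV[OF A] by (simp add: H.borel_UNIV)
    then show "((\<lambda>y. measure (N y) A) \<longlongrightarrow> 0) at_top"
      unfolding measure_N_eq_cdf_H[OF A]
      using tendsto_diff[OF tendsto_const H.cdf_lim_at_top, of "measure P A"] by simp
    show "((\<lambda>z. measure (N z) A) \<longlongrightarrow> measure (N y) A) (at_right y)"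
      unfolding measure_N_eq_cdf_H[OF A]
      by (intro tendsto_intros H.cdf_is_right_cont[unfolded continuous_within])
    show "((\<lambda>y. measure (N y) A) \<longlongrightarrow> measure P A) at_bot"
      unfolding measure_N_eq_cdf_H[OF A]
      using tendsto_diff[OF tendsto_const H.cdf_lim_at_bot] by simp
    show "y \<le> z \<Longrightarrow> measure (N z) A \<le> measure (N y) A"
      unfolding measure_N_eq_cdf_H[OF A] using H.cdf_nondecreasing by simp
  qed
  show ?thesis by (rule increasing_ratio_family.intro[OF assms *(4) *(1) *(2) *(3)])
qed

text \<open>For fixed \<open>A\<close> both sides of the kernel equation are finite measures in the
  second set, and they agree on the open upper half-lines, an intersection-stable generator of the
  Borel sets.\<close>

lemma conditional_kernel_of_tails:
  assumes K: "K \<in> borel \<rightarrow>\<^sub>M prob_algebra borel"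
    and tails: "\<And>A y. A \<in> sets borel \<Longrightarrow> measure R (A \<times> {y<..}) = (LINT x:A|P. measure (K x) {y<..})"
  shows "conditional_kernel R P K"
proof -
  interpret P: finite_borel_measure P by (rule finite_borel_measure_P)
  note [measurable_cong] = P.M_is_borel
  note [measurable] = K
  have K_prob: "prob_space (K x)" and K_sets: "sets (K x) = sets borel" for x
    using measurable_space[OF K, of x] by (auto simp: space_prob_algebra)
  have K_meas[measurable]: "(\<lambda>x. measure (K x) B) \<in> borel_measurable borel" if "B \<in> sets borel" for B
    using that by measurable
  have "measure R (A \<times> B) = (LINT x:A|P. measure (K x) B)"
    if A[measurable]: "A \<in> sets borel" and B[measurable]: "B \<in> sets borel" for A B
  proof -
    \<comment> \<open>The mixture of the kernel over \<open>A\<close>; building it with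
      \<open>bind\<close> makes it a measure without a separate proof of countable
      additivity.\<close>
    define L where "L = density P (indicator A) \<bind> K"
    have K': "K \<in> density P (indicator A) \<rightarrow>\<^sub>M subprob_algebra borel"
      using measurable_prob_algebraD[OF K] by measurable
    have ne: "space (density P (indicator A)) \<noteq> {}" by (simp add: P.borel_UNIV)
    have L: "emeasure L B = ennreal (LINT x:A|P. measure (K x) B)" if [measurable]: "B \<in> sets borel" for B
    proof -
      have e: "emeasure (K x) B = ennreal (measure (K x) B)" for x
        by (rule finite_measure.emeasure_eq_measure) (simp add: K_prob prob_space.finite_measure)
      have i: "integrable P (\<lambda>x. indicat_real A x * measure (K x) B)"
        using prob_space.prob_le_1[OF K_prob]
        by (intro P.integrable_const_bound[of _ 1]) (auto split: split_indicator)
      have "emeasure L B = (\<integral>\<^sup>+x. emeasure (K x) B \<partial>density P (indicator A))"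
        unfolding L_def by (rule emeasure_bind[OF ne K' that])
      also have "\<dots> = (\<integral>\<^sup>+x. ennreal (indicat_real A x * measure (K x) B) \<partial>P)"
        unfolding e by (subst nn_integral_density) (auto intro!: nn_integral_cong split: split_indicator)
      also have "\<dots> = ennreal (LINT x:A|P. measure (K x) B)"
        using i by (subst nn_integral_eq_integral) (auto simp: set_lebesgue_integral_def)
      finally show ?thesis .
    qed
    interpret H: finite_borel_measure "H A" by (rule finite_borel_measure_H[OF A])
    have b: "sets borel = sigma_sets UNIV (range (\<lambda>x::real. {x<..}))"
      unfolding borel_Ioi by (subst sets_measure_of) auto
    have "{x<..} \<inter> {y<..} = {max x y<..}" for x y :: real by auto
    then have Int: "Int_stable (range (\<lambda>x::real. {x<..}))"
      by (auto simp: Int_stable_def)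
    have "H A = L"
    proof (rule measure_eqI_generator_eq[where \<Omega> = UNIV and E = "range (\<lambda>x::real. {x<..})"
          and A = "\<lambda>n. {- real n<..}"])
      show "emeasure (H A) B = emeasure L B" if "B \<in> range (\<lambda>x::real. {x<..})" for B
        using that by (auto simp: L H.emeasure_eq_measure measure_H tails A)
      show "sets L = sigma_sets UNIV (range (\<lambda>x::real. {x<..}))"
        unfolding L_def using sets_bind[OF _ ne, of K borel] b K_sets by simp
      show "(\<Union>n. {- real n<..}) = UNIV"
        by (auto, metis reals_Archimedean2 minus_less_iff)
    qed (auto simp: Int b[symmetric] H.M_is_borel)
    then have "ennreal (measure R (A \<times> B)) = ennreal (LINT x:A|P. measure (K x) B)"
      using L[OF B] H.emeasure_eq_measure[of B] unfolding measure_H[OF A B] by (simp only:)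
    moreover have "0 \<le> (LINT x:A|P. measure (K x) B)"
      by (auto simp: set_lebesgue_integral_def intro!: integral_nonneg_AE)
    ultimately show ?thesis by simp
  qed
  then show ?thesis
    unfolding conditional_kernel_def using K_prob K_sets K_meas by blast
qed

lemma order_ineq_of_kernel:
  assumes K: "conditional_kernel R P K"
    and mono: "\<And>x\<^sub>1 x\<^sub>2. x\<^sub>1 \<in> rv_range M X \<Longrightarrow> x\<^sub>2 \<in> rv_range M X \<Longrightarrow> x\<^sub>1 < x\<^sub>2 \<Longrightarrow> stoch_le (K x\<^sub>1) (K x\<^sub>2)"
    and A: "A\<^sub>1 \<in> sets borel" "A\<^sub>2 \<in> sets borel" "set_less A\<^sub>1 A\<^sub>2"
  shows "order_ineq R P A\<^sub>1 A\<^sub>2 y"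
proof -
  interpret P: finite_borel_measure P by (rule finite_borel_measure_P)
  note [measurable_cong] = P.M_is_borel
  define k where "k x = measure (K x) {y<..}" for x
  have k01: "0 \<le> k x" "k x \<le> 1" for x
    using K prob_space.prob_le_1 unfolding k_def conditional_kernel_def by auto
  have [measurable]: "k \<in> borel_measurable borel"
    using K unfolding k_def conditional_kernel_def by auto
  have RI: "measure R (A \<times> {y<..}) = (LINT x:A|P. k x)" if "A \<in> sets borel" for A
    using K that unfolding k_def conditional_kernel_def by auto
  have int: "set_integrable P A k" if [measurable]: "A \<in> sets borel" for A
    unfolding set_integrable_def using k01
    by (intro P.integrable_const_bound[of _ 1]) (auto split: split_indicator)
  have const: "set_integrable P A (\<lambda>x. c)" "(LINT x:A|P. c) = c * measure P A"
    if [measurable]: "A \<in> sets borel" for A and c :: real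
  proof -
    have "integrable P (indicat_real A)"
      by (intro integrable_real_indicator) (auto simp: P.emeasure_eq_measure)
    then show "set_integrable P A (\<lambda>x. c)" "(LINT x:A|P. c) = c * measure P A"
      using that P.M_is_borel by (auto simp: set_integrable_def set_lebesgue_integral_def)
  qed
  have AE: "AE x in P. x \<in> rv_range M X"
    using P.AE_distr_range by (simp add: distr_range_P)
  show ?thesis
  \<comment> \<open>If \<open>A\<^sub>1\<close> misses the range, it is null for \<open>P\<close>
    and both sides vanish. Otherwise the supremum \<open>s\<close> below is taken over a nonempty
    set, as the bound \<open>s \<le> k x\<close> on \<open>A\<^sub>2\<close> requires.\<close>
  proof (cases "A\<^sub>1 \<inter> rv_range M X = {}")
    case True
    then have "AE x in P. x \<notin> A\<^sub>1" using AE by (auto elim!: eventually_mono)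
    then have "measure P A\<^sub>1 = 0"
      using A(1) by (simp add: AE_iff_measurable P.M_is_borel P.borel_UNIV measure_def)
    then show ?thesis
      using measure_R_le_P[OF A(1), of "{y<..}"] measure_nonneg[of R "A\<^sub>1 \<times> {y<..}"]
      unfolding order_ineq_def by simp
  next
    case False
    define s where "s = (SUP x\<in>A\<^sub>1 \<inter> rv_range M X. k x)"
    have "bdd_above (k ` (A\<^sub>1 \<inter> rv_range M X))" using k01 by (intro bdd_aboveI[of _ 1]) auto
    then have s1: "k x \<le> s" if "x \<in> A\<^sub>1" "x \<in> rv_range M X" for x
      unfolding s_def using that by (intro cSUP_upper) auto
    have s2: "s \<le> k x" if "x \<in> A\<^sub>2" "x \<in> rv_range M X" for x
      unfolding s_def using that mono A(3) False
      by (intro cSUP_least) (auto simp: k_def stoch_le_def set_less_def)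
    have "(LINT x:A\<^sub>1|P. k x) \<le> (LINT x:A\<^sub>1|P. s)"
      by (rule set_integral_mono_AE[OF int[OF A(1)] const(1)[OF A(1)]])
        (use AE s1 in \<open>auto elim!: eventually_mono\<close>)
    then have 1: "measure R (A\<^sub>1 \<times> {y<..}) \<le> s * measure P A\<^sub>1"
      using A by (simp add: RI const)
    have "(LINT x:A\<^sub>2|P. s) \<le> (LINT x:A\<^sub>2|P. k x)"
      by (rule set_integral_mono_AE[OF const(1)[OF A(2)] int[OF A(2)]])
        (use AE s2 in \<open>auto elim!: eventually_mono\<close>)
    then have 2: "s * measure P A\<^sub>2 \<le> measure R (A\<^sub>2 \<times> {y<..})"
      using A by (simp add: RI const)
    have "measure R (A\<^sub>1 \<times> {y<..}) * measure P A\<^sub>2 \<le> (s * measure P A\<^sub>1) * measure P A\<^sub>2"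
      by (intro mult_right_mono 1) simp
    also have "\<dots> = measure P A\<^sub>1 * (s * measure P A\<^sub>2)" by simp
    also have "\<dots> \<le> measure P A\<^sub>1 * measure R (A\<^sub>2 \<times> {y<..})"
      by (intro mult_left_mono 2) simp
    finally show ?thesis unfolding order_ineq_def .
  qed
qed

end

theorem theorem11:
  fixes M :: "'a measure" and X Y :: "'a \<Rightarrow> real"
    and R :: "(real \<times> real) measure" and P :: "real measure"
  assumes "prob_space M"
    and "X \<in> borel_measurable M" and "Y \<in> borel_measurable M"
  defines "R \<equiv> distr M (borel \<Otimes>\<^sub>M borel) (\<lambda>\<omega>. (X \<omega>, Y \<omega>))"
    and "P \<equiv> distr M borel X"
  defines "cond_i \<equiv> (\<forall>A\<^sub>1\<in>sets borel. \<forall>A\<^sub>2\<in>sets borel. \<forall>y.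
             set_less A\<^sub>1 A\<^sub>2 \<longrightarrow> order_ineq R P A\<^sub>1 A\<^sub>2 y)"
    and "cond_ii \<equiv> (\<exists>D :: real set. closure D = UNIV \<and>
             (\<forall>x\<^sub>0\<in>D. \<forall>x\<^sub>1\<in>D. \<forall>x\<^sub>2\<in>D. \<forall>y\<in>D. x\<^sub>0 < x\<^sub>1 \<longrightarrow> x\<^sub>1 < x\<^sub>2 \<longrightarrow>
                order_ineq R P {x\<^sub>0<..x\<^sub>1} {x\<^sub>1<..x\<^sub>2} y))"
    and "cond_iii \<equiv> (\<exists>K. conditional_kernel R P K \<and>
             (\<forall>x\<^sub>1\<in>rv_range M X. \<forall>x\<^sub>2\<in>rv_range M X. x\<^sub>1 < x\<^sub>2 \<longrightarrow> stoch_le (K x\<^sub>1) (K x\<^sub>2)))"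
  shows "(cond_i \<longleftrightarrow> cond_ii) \<and> (cond_ii \<longleftrightarrow> cond_iii)"
proof -
  interpret J: joint_law M X Y
    using assms(1-3) by (intro joint_law.intro joint_law_axioms.intro)
  have RP: "R = J.R" "P = J.P" unfolding R_def P_def J.R_def J.P_def by simp_all
  have "cond_ii" if cond_i
    using that unfolding cond_i_def cond_ii_def
    by (intro exI[of _ UNIV]) (auto simp: set_less_def)
  moreover have "cond_iii" if cond_ii
  proof -
    from that obtain D where D: "closure D = UNIV"
      "\<forall>x\<^sub>0\<in>D. \<forall>x\<^sub>1\<in>D. \<forall>x\<^sub>2\<in>D. \<forall>y\<in>D. x\<^sub>0 < x\<^sub>1 \<longrightarrow> x\<^sub>1 < x\<^sub>2 \<longrightarrow>
        order_ineq J.R J.P {x\<^sub>0<..x\<^sub>1} {x\<^sub>1<..x\<^sub>2} y"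
      unfolding cond_ii_def RP by blast
    interpret F: increasing_ratio_family J.P J.N
      by (intro J.increasing_ratio_familyI J.increasing_ratio_of_dense[OF D(1)]) (use D(2) in blast)
    have "conditional_kernel J.R J.P F.K"
      by (intro J.conditional_kernel_of_tails F.K_measurable)
        (simp add: J.measure_N[symmetric] F.measure_N_eq_integral_K)
    then show ?thesis
      unfolding cond_iii_def RP using F.stoch_le_K by (auto simp: J.distr_range_P)
  qed
  moreover have "cond_i" if cond_iii
    using that unfolding cond_i_def cond_iii_def RP by (blast intro: J.order_ineq_of_kernel)
  ultimately show ?thesis by blast
qed

end
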